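(* Let $(\mathcal{X},d)$ be a complete separable metric space and $I=[0,T]\subset\mathbb{R}$. Let $(\mu_t)_{t\in I}$ be a family of Borel probability measures on $\mathcal{X}$. Let $\Psi: C(I;\mathcal{X})\to[0,+\infty]$ be a lower semi-continuous map whose sublevels $\{\gamma:\Psi(\gamma)\le c\}$, $c\geq 0$, are relatively compact in $C(I;\mathcal{X})$. Assume that $$\inf_{\pi\in\mathrm{Lift}(\mu_t)}\int_{C(I;\mathcal{X})}\Psi(\gamma)\,d\pi(\gamma)<+\infty .$$ Then there exists $\pi\in\mathrm{Lift}(\mu_t)$ attaining this infimum.
   Context: $C(I;\mathcal{X})$ is the space of continuous paths $\gamma:I\to\mathcal{X}$ with the supremum distance $d_\infty(\gamma,\tilde\gamma)=\sup_{t\in I}d(\gamma_t,\tilde\gamma_t)$ and its Borel $\sigma$-algebra (which coincides with the $\sigma$-algebra generated by the evaluation maps). $P(\mathcal{Y})$ denotes the Borel probability measures on a metric space $\mathcal{Y}$. The evaluation map is $e_t(\gamma)=\gamma_t$. The set of lifts is $$\mathrm{Lift}(\mu_t)=\{\pi\in P(C(I;\mathcal{X})):\ (e_t)_\#\pi=\mu_t\ \text{for all } t\in I\},$$ which may be empty; the infimum over the empty set is $+\infty$. *)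

theory Defs
  imports "HOL-Analysis.Analysis" "HOL-Probability.Probability"
begin

definition lsc_map :: "'a topology \<Rightarrow> ('a \<Rightarrow> 'b::linorder) \<Rightarrow> bool" where
  "lsc_map X f \<longleftrightarrow>
    (\<forall>x\<in>topspace X. \<forall>a. a < f x \<longrightarrow> (\<exists>U. openin X U \<and> x \<in> U \<and> (\<forall>y\<in>U. a < f y)))"

definition relatively_compactin :: "'a topology \<Rightarrow> 'a set \<Rightarrow> bool" where
  "relatively_compactin X S \<longleftrightarrow> S \<subseteq> topspace X \<and> compactin X (X closure_of S)"

text \<open>The space of continuous paths on the interval from 0 to \<open>T\<close> with the supremum distance.
  A path is represented by a function on the whole real line that takes the value
  \<open>undefined\<close> outside the interval.\<close>

definition path_metric :: "real \<Rightarrow> (real \<Rightarrow> 'x::metric_space) metric" where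
  "path_metric T = cfunspace (top_of_set {0..T}) euclidean_metric"

abbreviation paths :: "real \<Rightarrow> (real \<Rightarrow> 'x::metric_space) set" where
  "paths T \<equiv> mspace (path_metric T)"

abbreviation path_topology :: "real \<Rightarrow> (real \<Rightarrow> 'x::metric_space) topology" where
  "path_topology T \<equiv> mtopology_of (path_metric T)"

definition path_borel :: "real \<Rightarrow> (real \<Rightarrow> 'x::metric_space) measure" where
  "path_borel T = sigma (paths T) {U. openin (path_topology T) U}"

lemma paths_eq: "paths T = {\<gamma> \<in> extensional {0..T}. continuous_on {0..T} \<gamma>}"
proof -
  have "compactin (top_of_set {0..T}) (topspace (top_of_set {0..T}))"
    by (simp add: compactin_subtopology)
  then show ?thesis
    unfolding path_metric_def by (subst compactin_mspace_cfunspace) auto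
qed

lemma mdist_path_metric:
  fixes \<gamma> \<eta> :: "real \<Rightarrow> 'x::metric_space"
  assumes "0 \<le> T" "\<gamma> \<in> paths T" "\<eta> \<in> paths T"
  shows "mdist (path_metric T) \<gamma> \<eta> = (SUP t\<in>{0..T}. dist (\<gamma> t) (\<eta> t))"
proof -
  have "paths T \<subseteq> mspace (funspace {0..T} (euclidean_metric :: 'x metric))"
    using cfunspace_subset_funspace[of "top_of_set {0..T}" "euclidean_metric :: 'x metric"]
    unfolding path_metric_def by (simp only: topspace_euclidean_subtopology)
  then have "paths T \<subseteq> (Met_TC.fspace {0..T} :: (real \<Rightarrow> 'x) set)"
    by (simp only: mspace_funspace mspace_euclidean_metric mdist_euclidean_metric)
  then have "\<gamma> \<in> Met_TC.fspace {0..T}" "\<eta> \<in> Met_TC.fspace {0..T}"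
    using assms by blast+
  then show ?thesis
    using assms(1) by (simp add: path_metric_def mdist_cfunspace_eq_mdist_funspace Met_TC.fdist_def)
qed

text \<open>The measures in \<open>space (prob_algebra M)\<close> are the probability measures on the
  \<open>\<sigma>\<close>-algebra of \<open>M\<close>.\<close>

definition Lift :: "real \<Rightarrow> (real \<Rightarrow> 'x::metric_space measure) \<Rightarrow> (real \<Rightarrow> 'x) measure set" where
  "Lift T \<mu> = {\<pi> \<in> space (prob_algebra (path_borel T)). \<forall>t\<in>{0..T}. distr \<pi> borel (\<lambda>\<gamma>. \<gamma> t) = \<mu> t}"

text \<open>Since \<open>distr\<close> is only meaningful for measurable maps, we check that the evaluations
  are measurable.\<close>

lemma measurable_eval:
  assumes "t \<in> {0..T}"
  shows "(\<lambda>\<gamma>. \<gamma> t) \<in> path_borel T \<rightarrow>\<^sub>M (borel :: 'x::metric_space measure)"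
proof (rule borel_measurableI)
  fix S :: "'x set"
  assume S: "open S"
  let ?A = "(\<lambda>\<gamma>. \<gamma> t) -` S \<inter> paths T"
  interpret M: Metric_space "paths T :: (real \<Rightarrow> 'x) set" "mdist (path_metric T)"
    by simp
  have sub: "{U. openin (path_topology T :: (real \<Rightarrow> 'x) topology) U} \<subseteq> Pow (paths T)"
    using openin_subset by fastforce
  have "openin (path_topology T) ?A"
    unfolding mtopology_of_def M.openin_mtopology
  proof (intro conjI allI impI)
    fix \<gamma>
    assume \<gamma>: "\<gamma> \<in> ?A"
    then obtain e where e: "e > 0" "\<And>y. dist y (\<gamma> t) < e \<Longrightarrow> y \<in> S"
      using S by (auto simp: open_dist)
    have "\<eta> \<in> ?A" if \<eta>: "\<eta> \<in> M.mball \<gamma> (e/2)" for \<eta>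
    proof -
      have d: "\<eta> \<in> paths T" "mdist (path_metric T) \<gamma> \<eta> \<le> e/2"
        using \<eta> by (auto simp: M.in_mball)
      have "dist (\<gamma> t) (\<eta> t) \<le> e/2"
        using mdist_cfunspace_imp_mdist_le[of \<gamma> "top_of_set {0..T}" euclidean_metric \<eta> "e/2" t]
          d \<gamma> assms by (simp add: path_metric_def)
      then show ?thesis
        using e d by (auto simp: dist_commute)
    qed
    then show "\<exists>r>0. M.mball \<gamma> r \<subseteq> ?A"
      using e by (intro exI[of _ "e/2"]) auto
  qed auto
  then show "(\<lambda>\<gamma>. \<gamma> t) -` S \<inter> space (path_borel T) \<in> sets (path_borel T)"
    using sub by (auto simp: path_borel_def space_measure_of sets_measure_of)
qed

end

theory Submission
  imports Defs
begin

text \<open>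
  Along a minimising sequence of lifts the integrals of \<open>\<Psi>\<close> are bounded, so by Markov's inequality
  the sequence is tight with respect to the compact sublevels of \<open>\<Psi>\<close>. To extract a limit, encode
  a point \<open>x\<close> of the union of the compact sets \<open>K j\<close> by a real number: its integer part is the least
  \<open>j\<close> with \<open>x \<in> K j\<close>, and its base 4 digits record to which members of a countable family of balls
  \<open>x\<close> belongs. Tightness passes to the laws of the codes, so Helly's selection theorem and Skorohod's
  theorem on the real line give almost surely convergent random variables with these laws. If the
  codes of a sequence of points converge, the points eventually stay in one \<open>K j\<close> and are Cauchy, so
  decoding gives random paths, with the laws of a subsequence of the lifts, that converge almost
  surely. The law of the limit is again a lift, since the time marginals are constant along the
  sequence, and it is a minimiser by Fatou's lemma and the lower semicontinuity of \<open>\<Psi>\<close>.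
\<close>

subsection \<open>Encoding bit sequences by real numbers\<close>

text \<open>Base 4 with the digits 0 and 1 only: the gaps between the admissible expansions
  make the digits locally constant on the range.\<close>

definition quaternary :: "(nat \<Rightarrow> bool) \<Rightarrow> real" where
  "quaternary b = (\<Sum>i. of_bool (b i) / 4 ^ Suc i)"

lemma summable_quaternary: "summable (\<lambda>i. of_bool (b i) / 4 ^ Suc i :: real)"
proof (rule summable_comparison_test')
  show "summable (\<lambda>i. (1 / 4) ^ Suc i :: real)"
    by (subst summable_Suc_iff) (simp add: summable_geometric)
  show "norm (of_bool (b i) / 4 ^ Suc i :: real) \<le> (1 / 4) ^ Suc i" for i
    by (simp add: power_one_over divide_simps)
qed

lemma quaternary_nonneg: "0 \<le> quaternary b"
  unfolding quaternary_def by (intro suminf_nonneg summable_quaternary) simp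

text \<open>Because only the digits 0 and 1 occur, every tail stays below 1/3. The gap from 1/3 to 1
  lets integer parts be recovered even from approximate values.\<close>

lemma quaternary_le: "quaternary b \<le> 1 / 3"
proof -
  have s: "(\<lambda>i. (1 / 4) * (1 / 4) ^ i :: real) sums ((1 / 4) * (1 / (1 - 1 / 4)))"
    by (intro sums_mult geometric_sums) simp
  have "quaternary b \<le> (\<Sum>i. (1 / 4) * (1 / 4) ^ i)"
    unfolding quaternary_def
    by (intro suminf_le summable_quaternary sums_summable[OF s]) (simp add: power_one_over divide_simps)
  then show ?thesis
    using sums_unique[OF s] by simp
qed

lemma quaternary_unfold: "4 * quaternary b = of_bool (b 0) + quaternary (\<lambda>i. b (Suc i))"
proof -
  have "quaternary b = of_bool (b 0) / 4 + (\<Sum>i. of_bool (b (Suc i)) / 4 ^ Suc (Suc i))"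
    using suminf_split_head[OF summable_quaternary, of b] by (simp add: quaternary_def)
  also have "(\<Sum>i. of_bool (b (Suc i)) / 4 ^ Suc (Suc i)) = quaternary (\<lambda>i. b (Suc i)) / 4"
    unfolding quaternary_def
    by (subst suminf_divide[OF summable_quaternary, symmetric]) (simp add: field_simps)
  finally show ?thesis by simp
qed

text \<open>Scaling by \<open>4 ^ n\<close> moves the first \<open>n\<close> digits into the integer
  part and leaves the remaining tail as the fractional part.\<close>

lemma quaternary_shift:
  "\<exists>k::int. 4 ^ n * (of_nat j + quaternary b) = of_int k + quaternary (\<lambda>i. b (n + i))"
proof (induction n)
  case 0
  show ?case by (rule exI[of _ "int j"]) simp
next
  case (Suc n)
  then obtain k :: int where "4 ^ n * (of_nat j + quaternary b) = of_int k + quaternary (\<lambda>i. b (n + i))"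
    by blast
  then have "4 ^ Suc n * (of_nat j + quaternary b) = 4 * of_int k + 4 * quaternary (\<lambda>i. b (n + i))"
    by (simp add: algebra_simps)
  also have "\<dots> = of_int (4 * k + of_bool (b n)) + quaternary (\<lambda>i. b (Suc n + i))"
    by (subst quaternary_unfold) simp
  finally show ?case by blast
qed

lemma floor_quaternary_digit: "\<lfloor>4 ^ Suc n * (of_nat j + quaternary b)\<rfloor> mod 4 = of_bool (b n)"
proof -
  obtain k :: int where k: "4 ^ n * (of_nat j + quaternary b) = of_int k + quaternary (\<lambda>i. b (n + i))"
    using quaternary_shift by blast
  then have "4 ^ Suc n * (of_nat j + quaternary b) = 4 * of_int k + 4 * quaternary (\<lambda>i. b (n + i))"
    by (simp add: algebra_simps)
  also have "\<dots> = of_int (4 * k + of_bool (b n)) + quaternary (\<lambda>i. b (Suc n + i))"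
    by (subst quaternary_unfold) simp
  finally have "\<lfloor>4 ^ Suc n * (of_nat j + quaternary b)\<rfloor> = 4 * k + of_bool (b n)"
    using quaternary_nonneg[of "\<lambda>i. b (Suc n + i)"] quaternary_le[of "\<lambda>i. b (Suc n + i)"]
    by (intro floor_unique) auto
  then show ?thesis by simp
qed

text \<open>After scaling, the two numbers differ by less than 1/3 and their tails by at most 1/3.
  The integers \<open>k\<close> and \<open>k'\<close> thus differ by less than 2/3, so they
  coincide.\<close>

lemma quaternary_close:
  assumes "\<bar>(of_nat j + quaternary b) - (of_nat j' + quaternary b')\<bar> < 1 / (3 * 4 ^ n)"
  shows "\<lfloor>4 ^ n * (of_nat j + quaternary b)\<rfloor> = \<lfloor>4 ^ n * (of_nat j' + quaternary b')\<rfloor>"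
proof -
  obtain k k' :: int where k: "4 ^ n * (of_nat j + quaternary b) = of_int k + quaternary (\<lambda>i. b (n + i))"
    and k': "4 ^ n * (of_nat j' + quaternary b') = of_int k' + quaternary (\<lambda>i. b' (n + i))"
    using quaternary_shift by metis
  have q: "0 \<le> quaternary b" "quaternary b \<le> 1 / 3" for b
    by (rule quaternary_nonneg quaternary_le)+
  have "\<bar>4 ^ n * ((of_nat j + quaternary b) - (of_nat j' + quaternary b'))\<bar> < 1 / 3"
    using assms by (simp add: abs_mult mult.commute pos_less_divide_eq)
  then have "\<bar>of_int (k - k') + quaternary (\<lambda>i. b (n + i)) - quaternary (\<lambda>i. b' (n + i))\<bar> < 1 / 3"
    unfolding right_diff_distrib k k' by (simp add: algebra_simps)
  then have "\<bar>of_int (k - k') :: real\<bar> < 1"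
    using q[of "\<lambda>i. b (n + i)"] q[of "\<lambda>i. b' (n + i)"] by linarith
  then have "k = k'" by linarith
  moreover have "\<lfloor>of_int l + quaternary b\<rfloor> = l" for l b
    using q[of b] by (intro floor_unique) auto
  ultimately show ?thesis
    unfolding k k' by simp
qed

text \<open>The floors agree at every scale up to \<open>n\<close>: scale 0 yields the integer part,
  and scale \<open>Suc i\<close> yields digit \<open>i\<close> modulo 4.\<close>

lemma quaternary_close_imp:
  assumes "\<bar>(of_nat j + quaternary b) - (of_nat j' + quaternary b')\<bar> < 1 / (3 * 4 ^ n)"
  shows "j = j'" and "i < n \<Longrightarrow> b i = b' i"
proof -
  have *: "\<lfloor>4 ^ m * (of_nat j + quaternary b)\<rfloor> = \<lfloor>4 ^ m * (of_nat j' + quaternary b')\<rfloor>" if "m \<le> n" for m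
  proof (rule quaternary_close)
    have "1 / (3 * 4 ^ n) \<le> 1 / (3 * 4 ^ m :: real)"
      using that by (intro divide_left_mono mult_left_mono power_increasing) auto
    then show "\<bar>(of_nat j + quaternary b) - (of_nat j' + quaternary b')\<bar> < 1 / (3 * 4 ^ m)"
      using assms by linarith
  qed
  have "\<lfloor>of_nat j + quaternary b\<rfloor> = int j" for j b
    using quaternary_nonneg[of b] quaternary_le[of b] by (intro floor_unique) auto
  then show "j = j'"
    using *[of 0] by simp
  show "b i = b' i" if "i < n"
    using *[of "Suc i"] that floor_quaternary_digit[of i j b] floor_quaternary_digit[of i j' b'] 
    by (metis Suc_leI of_bool_eq_iff)
qed

subsection \<open>Encoding a countable union of compact sets\<close>

text \<open>Finite nets of radius \<open>1 / real (Suc n)\<close> for all the \<open>K j\<close> are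
  listed in one sequence; \<open>N\<close> bounds the finitely many indices used by one net that is
  fine enough for \<open>e\<close>.\<close>

lemma compact_sequence_fine_balls:
  fixes K :: "nat \<Rightarrow> 'a::metric_space set"
  assumes "\<And>j. compact (K j)"
  shows "\<exists>(c :: nat \<Rightarrow> 'a) r. \<forall>j. \<forall>e>0. \<exists>N. \<forall>x\<in>K j. \<exists>i<N. dist (c i) x < r i \<and> r i < e"
proof -
  have "\<exists>F. finite F \<and> K j \<subseteq> (\<Union>x\<in>F. ball x (1 / real (Suc n)))" for j n
    using assms[of j] by (auto simp: compact_eq_totally_bounded)
  then obtain F where F: "\<And>j n. finite (F j n)" "\<And>j n. K j \<subseteq> (\<Union>x\<in>F j n. ball x (1 / real (Suc n)))"
    by metis
  \<comment> \<open>The dummy pair keeps \<open>P\<close> nonempty even if all nets are empty, so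
    that \<open>from_nat_into\<close> enumerates exactly \<open>P\<close>.\<close>
  define P where "P = insert (undefined, 1) (\<Union>j n. F j n \<times> {1 / real (Suc n)})"
  have P: "P \<noteq> {}" "countable P"
    unfolding P_def using F(1)
    by (simp_all add: countable_finite)
  define p where "p = from_nat_into P"
  have range: "range p = P"
    unfolding p_def using P by (rule range_from_nat_into)
  show ?thesis
  proof (intro exI[of _ "\<lambda>i. fst (p i)"] exI[of _ "\<lambda>i. snd (p i)"] allI impI)
    fix j and e :: real
    assume "e > 0"
    then obtain n where n: "1 / real (Suc n) < e"
      using nat_approx_posE by blast
    have "finite (F j n \<times> {1 / real (Suc n)})" "F j n \<times> {1 / real (Suc n)} \<subseteq> range p"
      using F(1) unfolding range P_def by auto
    then obtain I where I: "finite I" "F j n \<times> {1 / real (Suc n)} = p ` I"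
      by (meson finite_subset_image)
    obtain N where N: "\<forall>i\<in>I. i < N"
      using I(1) by (meson finite_nat_set_iff_bounded)
    have "\<exists>i<N. dist (fst (p i)) x < snd (p i) \<and> snd (p i) < e" if "x \<in> K j" for x
    proof -
      obtain y where y: "y \<in> F j n" "dist y x < 1 / real (Suc n)"
        using F(2) \<open>x \<in> K j\<close> by fastforce
      then have "(y, 1 / real (Suc n)) \<in> p ` I"
        using I(2) by auto
      then obtain i where "i \<in> I" "p i = (y, 1 / real (Suc n))"
        by auto
      then show ?thesis
        using y n N by (intro exI[of _ i]) auto
    qed
    then show "\<exists>N. \<forall>x\<in>K j. \<exists>i<N. dist (fst (p i)) x < snd (p i) \<and> snd (p i) < e"
      by blast
  qed
qed

text \<open>As \<open>N\<close> is uniform on \<open>K j\<close>, two points of \<open>K j\<close>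
  whose first \<open>N\<close> bits agree lie in a common ball of radius below
  \<open>e\<close>.\<close>

locale fine_balls =
  fixes K :: "nat \<Rightarrow> 'a::complete_space set" and c :: "nat \<Rightarrow> 'a" and r :: "nat \<Rightarrow> real"
  assumes compact_K: "\<And>j. compact (K j)"
    and fine: "\<And>j e. e > 0 \<Longrightarrow> \<exists>N. \<forall>x\<in>K j. \<exists>i<N. dist (c i) x < r i \<and> r i < e"
begin

definition bits :: "'a \<Rightarrow> nat \<Rightarrow> bool" where
  "bits x i \<longleftrightarrow> dist (c i) x < r i"

definition level :: "'a \<Rightarrow> nat" where
  "level x = (LEAST j. x \<in> K j)"

definition code :: "'a \<Rightarrow> real" where
  "code x = of_nat (level x) + quaternary (bits x)"

text \<open>The left inverse \<open>decode\<close> of \<open>code\<close> is built from the digits of an arbitrary real number, so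
  that its measurability does not depend on the range of \<open>code\<close> being a Borel set; its values
  outside this range are junk.\<close>

definition approx_index :: "nat \<Rightarrow> real \<Rightarrow> nat" where
  "approx_index n y = (LEAST i. \<lfloor>4 ^ Suc i * y\<rfloor> mod 4 = 1 \<and> r i < 1 / real (Suc n))"

text \<open>Codes of points of the union pass this test by the triangle inequality; conversely,
  passing it makes the chosen centres a Cauchy sequence.\<close>

definition decodable :: "real \<Rightarrow> bool" where
  "decodable y \<longleftrightarrow> (\<forall>m n. dist (c (approx_index m y)) (c (approx_index n y)) \<le> 1 / real (Suc m) + 1 / real (Suc n))"

text \<open>If the test fails, the sequence is constantly \<open>c 0\<close>. The limit thus exists
  for every real \<open>y\<close>, and \<open>decode\<close> is Borel as a pointwise limit of
  countably valued Borel maps.\<close>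

definition decode :: "real \<Rightarrow> 'a" where
  "decode y = lim (\<lambda>n. c (if decodable y then approx_index n y else 0))"

lemma closed_K: "closed (K j)"
  using compact_K by (rule compact_imp_closed)

lemma code_borel [measurable]: "code \<in> borel_measurable borel"
proof -
  have [measurable]: "K j \<in> sets borel" for j
    using closed_K by simp
  have [measurable]: "level \<in> borel \<rightarrow>\<^sub>M count_space UNIV"
    unfolding level_def by measurable
  have [measurable]: "Measurable.pred borel (\<lambda>x. bits x i)" for i
  proof -
    have "{x. bits x i} = ball (c i) (r i)" by (auto simp: bits_def)
    then show ?thesis by (simp add: pred_def)
  qed
  show ?thesis
    unfolding code_def quaternary_def of_bool_def by measurable
qed

lemma approx_index_measurable [measurable]: "approx_index n \<in> borel \<rightarrow>\<^sub>M count_space UNIV"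
  unfolding approx_index_def by measurable

lemma decodable_measurable [measurable]: "Measurable.pred borel decodable"
proof -
  have "Measurable.pred borel (\<lambda>y. dist (c (approx_index m y)) (c (approx_index n y)) \<le> e)" for m n e
  proof (rule measurable_compose_countable[where f = "\<lambda>i y. dist (c i) (c (approx_index n y)) \<le> e"])
    show "Measurable.pred borel (\<lambda>y. dist (c i) (c (approx_index n y)) \<le> e)" for i
      by (rule measurable_compose[OF approx_index_measurable]) simp
  qed (rule approx_index_measurable)
  then show ?thesis
    unfolding decodable_def by measurable
qed

lemma decode_tendsto: "(\<lambda>n. c (if decodable y then approx_index n y else 0)) \<longlonglongrightarrow> decode y"
proof (cases "decodable y")
  case True
  have "Cauchy (\<lambda>n. c (approx_index n y))"
  proof (rule metric_CauchyI)
    fix e :: real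
    assume "e > 0"
    then obtain N where N: "1 / real (Suc N) < e / 2"
      using nat_approx_posE[of "e / 2"] by auto
    have "dist (c (approx_index m y)) (c (approx_index n y)) < e" if "N \<le> m" "N \<le> n" for m n
    proof -
      have "1 / real (Suc m) \<le> 1 / real (Suc N)" "1 / real (Suc n) \<le> 1 / real (Suc N)"
        using that by (auto intro!: divide_left_mono)
      moreover have "dist (c (approx_index m y)) (c (approx_index n y)) \<le> 1 / real (Suc m) + 1 / real (Suc n)"
        using True by (simp add: decodable_def)
      ultimately show ?thesis using N by linarith
    qed
    then show "\<exists>N. \<forall>m\<ge>N. \<forall>n\<ge>N. dist (c (approx_index m y)) (c (approx_index n y)) < e"
      by blast
  qed
  then show ?thesis
    using True by (simp add: decode_def Cauchy_convergent_iff convergent_LIMSEQ_iff)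
qed (simp add: decode_def)

lemma decode_borel [measurable]: "decode \<in> borel_measurable borel"
proof (rule borel_measurable_LIMSEQ_metric[OF _ decode_tendsto])
  show "(\<lambda>y. c (if decodable y then approx_index n y else 0)) \<in> borel_measurable borel" for n
    by (rule measurable_compose[where N = "count_space UNIV"]) measurable
qed

text \<open>The digits of \<open>code x\<close> are the bits of \<open>x\<close>, so
  \<open>approx_index n\<close> finds a ball of radius below \<open>1 / real (Suc n)\<close> that
  contains \<open>x\<close>. The centres of these balls converge to \<open>x\<close>.\<close>

lemma decode_code:
  assumes "x \<in> (\<Union>j. K j)"
  shows "decode (code x) = x"
proof -
  have approx: "dist (c (approx_index n (code x))) x < 1 / real (Suc n)" for n
  proof -
    obtain j where "x \<in> K j" using assms by blast
    then obtain i where "dist (c i) x < r i" "r i < 1 / real (Suc n)"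
      using fine[of "1 / real (Suc n)" j] by auto
    then have "bits x i \<and> r i < 1 / real (Suc n)"
      by (simp add: bits_def)
    moreover have "approx_index n (code x) = (LEAST i. bits x i \<and> r i < 1 / real (Suc n))"
      unfolding approx_index_def code_def floor_quaternary_digit by simp
    ultimately have "bits x (approx_index n (code x)) \<and> r (approx_index n (code x)) < 1 / real (Suc n)"
      by (metis (mono_tags, lifting) LeastI)
    then show ?thesis
      by (simp add: bits_def)
  qed
  have "decodable (code x)"
    unfolding decodable_def
  proof (intro allI)
    fix m n
    have "dist (c (approx_index m (code x))) (c (approx_index n (code x)))
        \<le> dist (c (approx_index m (code x))) x + dist (c (approx_index n (code x))) x"
      by (rule dist_triangle2)
    then show "dist (c (approx_index m (code x))) (c (approx_index n (code x))) \<le> 1 / real (Suc m) + 1 / real (Suc n)"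
      using approx[of m] approx[of n] by linarith
  qed
  then have lim: "(\<lambda>n. c (approx_index n (code x))) \<longlonglongrightarrow> decode (code x)"
    using decode_tendsto[of "code x"] by simp
  have "(\<lambda>n. dist (c (approx_index n (code x))) x) \<longlonglongrightarrow> 0"
  proof (rule tendsto_sandwich[OF _ _ tendsto_const])
    show "(\<lambda>n. 1 / real (Suc n)) \<longlonglongrightarrow> 0"
      using LIMSEQ_inverse_real_of_nat by (simp add: inverse_eq_divide)
    show "\<forall>\<^sub>F n in sequentially. dist (c (approx_index n (code x))) x \<le> 1 / real (Suc n)"
      using approx by (intro always_eventually allI less_imp_le)
  qed simp
  then show ?thesis
    using lim LIMSEQ_unique tendsto_dist_iff by blast
qed

text \<open>Nearby codes share their level and many bits, so the points end up in one
  \<open>K J\<close> and pairwise in common small balls; completeness gives a limit. Nothing is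
  claimed about the code of the limit, since \<open>code\<close> need not be continuous.\<close>

lemma convergent_if_code_convergent:
  assumes x: "\<And>k. x k \<in> (\<Union>j. K j)" and conv: "convergent (\<lambda>k. code (x k))"
  shows "convergent x"
proof -
  have cauchy: "Cauchy (\<lambda>k. code (x k))"
    using conv by (rule convergent_Cauchy)
  have close: "\<exists>N. \<forall>k\<ge>N. \<forall>l\<ge>N. \<bar>code (x k) - code (x l)\<bar> < 1 / (3 * 4 ^ n)" for n
    using metric_CauchyD[OF cauchy, of "1 / (3 * 4 ^ n)"] by (simp add: dist_real_def)
  obtain N0 where "\<And>k l. k \<ge> N0 \<Longrightarrow> l \<ge> N0 \<Longrightarrow> \<bar>code (x k) - code (x l)\<bar> < 1 / (3 * 4 ^ 0)"
    using close[of 0] by blast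
  then have level: "level (x k) = level (x N0)" if "k \<ge> N0" for k
    using quaternary_close_imp(1) that unfolding code_def by blast
  define J where "J = level (x N0)"
  have xJ: "x k \<in> K J" if "k \<ge> N0" for k
  proof -
    have "x k \<in> K (level (x k))"
      using x[of k] unfolding level_def by (auto intro: LeastI)
    then show ?thesis
      using level[OF that] by (simp add: J_def)
  qed
  have "Cauchy x"
  proof (rule metric_CauchyI)
    fix e :: real
    assume "e > 0"
    \<comment> \<open>This number of bits suffices for all points of \<open>K J\<close> at once,
      which is why the level had to be fixed first.\<close>
    then obtain n where n: "\<And>z. z \<in> K J \<Longrightarrow> \<exists>i<n. dist (c i) z < r i \<and> r i < e / 2"
      using fine[of "e / 2" J] by auto
    obtain N where N: "\<And>k l. k \<ge> N \<Longrightarrow> l \<ge> N \<Longrightarrow> \<bar>code (x k) - code (x l)\<bar> < 1 / (3 * 4 ^ n)"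
      using close by blast
    have "dist (x k) (x l) < e" if k: "k \<ge> max N N0" and l: "l \<ge> max N N0" for k l
    proof -
      obtain i where i: "i < n" "dist (c i) (x k) < r i" "r i < e / 2"
        using n[OF xJ] k by auto
      have "bits (x k) i = bits (x l) i"
        using N k l i(1) unfolding code_def by (intro quaternary_close_imp(2)[of "level (x k)" _ "level (x l)" _ n]) auto
      with i(2) have "dist (c i) (x l) < r i"
        by (simp add: bits_def)
      then show ?thesis
        using i dist_triangle3[of "x k" "x l" "c i"] by linarith
    qed
    then show "\<exists>N. \<forall>k\<ge>N. \<forall>l\<ge>N. dist (x k) (x l) < e"
      by blast
  qed
  then show ?thesis
    by (rule Cauchy_convergent)
qed

end

text \<open>A combination of Prokhorov's theorem and Skorohod's representation theorem.\<close>

theorem tight_imp_AE_convergent_realization: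
  fixes M :: "nat \<Rightarrow> 'a::complete_space measure" and K :: "nat \<Rightarrow> 'a set"
  assumes M: "\<And>n. M n \<in> space (prob_algebra borel)"
    and K: "\<And>j. compact (K j)"
    and tight: "\<And>e::real. e > 0 \<Longrightarrow> \<exists>J. \<forall>n. 1 - e < measure (M n) (\<Union>j\<le>J. K j)"
  obtains \<Omega> :: "real measure" and X Z and \<rho> :: "nat \<Rightarrow> nat"
  where "prob_space \<Omega>" "strict_mono \<rho>"
    "\<And>n. X n \<in> borel_measurable \<Omega>" "\<And>n. distr \<Omega> borel (X n) = M (\<rho> n)"
    "Z \<in> borel_measurable \<Omega>" "AE \<omega> in \<Omega>. (\<lambda>n. X n \<omega>) \<longlonglongrightarrow> Z \<omega>"
proof -
  obtain c :: "nat \<Rightarrow> 'a" and r where "\<forall>j. \<forall>e>0. \<exists>N. \<forall>x\<in>K j. \<exists>i<N. dist (c i) x < r i \<and> r i < e"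
    using compact_sequence_fine_balls[of K] K by blast
  then interpret fine_balls K c r
    using K by unfold_locales auto
  interpret M: prob_space "M n" for n
    using M by (simp add: space_prob_algebra)
  have sets_M [measurable_cong]: "sets (M n) = sets borel" for n
    using M by (simp add: space_prob_algebra)
  have space_M: "space (M n) = UNIV" for n
    using sets_eq_imp_space_eq[OF sets_M] by simp
  have [measurable]: "K j \<in> sets borel" for j
    using closed_K by simp
  define S where "S = (\<Union>j. K j)"
  have [measurable]: "S \<in> sets borel"
    unfolding S_def by measurable
  \<comment> \<open>Letting \<open>e\<close> tend to 0 in the tightness bound shows that no mass
    lies outside the union, the set on which \<open>decode\<close> inverts
    \<open>code\<close>.\<close>
  have AE_S: "AE x in M n. x \<in> S" for n
  proof -
    have "1 - e \<le> measure (M n) S" if e: "e > 0" for e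
    proof -
      obtain J where "1 - e < measure (M n) (\<Union>j\<le>J. K j)"
        using tight[OF e] by blast
      also have "\<dots> \<le> measure (M n) S"
        by (rule M.finite_measure_mono) (auto simp: S_def)
      finally show ?thesis by simp
    qed
    then have "1 \<le> measure (M n) S"
      by (meson diff_le_eq field_le_epsilon)
    then have "measure (M n) S = 1"
      using M.prob_le_1[of n S] by linarith
    then show ?thesis
      by (subst M.AE_in_set_eq_1) auto
  qed
  define \<nu> where "\<nu> n = distr (M n) borel code" for n
  have real_\<nu>: "real_distribution (\<nu> n)" for n
    unfolding \<nu>_def by (rule M.real_distribution_distr) measurable
  have "tight \<nu>"
    unfolding tight_def
  proof (intro conjI allI impI)
    fix e :: real
    assume "e > 0"
    then obtain J where J: "\<And>n. 1 - e < measure (M n) (\<Union>j\<le>J. K j)"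
      using tight by blast
    \<comment> \<open>Codes on the first \<open>J + 1\<close> compact sets lie between 0 and
      \<open>J + 1/3\<close>. The left endpoint is -1 because the interval is open on the left and a
      code can be 0.\<close>
    have "1 - e < measure (\<nu> n) {-1<..real J + 1}" for n
    proof -
      have "-1 < code x \<and> code x \<le> real J + 1" if "x \<in> (\<Union>j\<le>J. K j)" for x
      proof -
        have "level x \<le> J"
          using that unfolding level_def by (auto intro: Least_le order_trans)
        then show ?thesis
          using quaternary_nonneg[of "bits x"] quaternary_le[of "bits x"] by (simp add: code_def)
      qed
      then have "(\<Union>j\<le>J. K j) \<subseteq> code -` {-1<..real J + 1} \<inter> space (M n)"
        unfolding space_M by fastforce
      then have "measure (M n) (\<Union>j\<le>J. K j) \<le> measure (M n) (code -` {-1<..real J + 1} \<inter> space (M n))"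
        by (rule M.finite_measure_mono) measurable
      also have "\<dots> = measure (\<nu> n) {-1<..real J + 1}"
        unfolding \<nu>_def by (subst measure_distr) auto
      finally show ?thesis
        using J[of n] by linarith
    qed
    then show "\<exists>a b. a < b \<and> (\<forall>n. 1 - e < measure (\<nu> n) {a<..b})"
      by (intro exI[of _ "-1"] exI[of _ "real J + 1"]) auto
  qed (rule real_\<nu>)
  then obtain \<rho> N where \<rho>: "strict_mono \<rho>" "real_distribution N" "weak_conv_m (\<nu> \<circ> \<rho>) N"
    using tight_imp_convergent_subsubsequence[of \<nu> id] by (auto simp: strict_mono_def)
  have "\<And>n. real_distribution ((\<nu> \<circ> \<rho>) n)"
    using real_\<nu> by simp
  from Skorohod[OF this \<rho>(2,3)]
  obtain \<Omega> :: "real measure" and Y :: "nat \<Rightarrow> real \<Rightarrow> real" and Y' where \<Omega>: "prob_space \<Omega>"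
    and Y [measurable]: "\<And>n. Y n \<in> borel_measurable \<Omega>"
    and distr_Y: "\<And>n. distr \<Omega> borel (Y n) = (\<nu> \<circ> \<rho>) n"
    and lim_Y: "\<And>\<omega>. \<omega> \<in> space \<Omega> \<Longrightarrow> (\<lambda>n. Y n \<omega>) \<longlonglongrightarrow> Y' \<omega>"
    by blast
  define X where "X = (\<lambda>n \<omega>. decode (Y n \<omega>))"
  have X [measurable]: "X n \<in> borel_measurable \<Omega>" for n
    unfolding X_def by measurable
  have distr_X: "distr \<Omega> borel (X n) = M (\<rho> n)" for n
  proof -
    have "distr \<Omega> borel (X n) = distr (distr \<Omega> borel (Y n)) borel decode"
      by (subst distr_distr) (auto simp: X_def comp_def)
    also have "\<dots> = distr (M (\<rho> n)) borel (\<lambda>x. decode (code x))"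
      unfolding distr_Y \<nu>_def comp_apply by (subst distr_distr) (auto simp: comp_def)
    also have "\<dots> = distr (M (\<rho> n)) (M (\<rho> n)) (\<lambda>x. x)"
    proof (rule distr_cong_AE)
      show "AE x in M (\<rho> n). decode (code x) = x"
        using AE_S by eventually_elim (simp add: S_def decode_code)
    qed (simp_all add: sets_M)
    finally show ?thesis
      by (simp add: distr_id)
  qed
  \<comment> \<open>\<open>Y n\<close> has the law of a code, so almost surely its value is a
    genuine code. Stating this through \<open>decode\<close> gives a Borel condition, which can be
    transferred between laws.\<close>
  have AE_code: "AE \<omega> in \<Omega>. X n \<omega> \<in> S \<and> code (X n \<omega>) = Y n \<omega>" for n
  proof -
    have "AE y in distr \<Omega> borel (Y n). decode y \<in> S \<and> code (decode y) = y"
      unfolding distr_Y \<nu>_def comp_apply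
    proof (subst AE_distr_iff)
      show "AE x in M (\<rho> n). decode (code x) \<in> S \<and> code (decode (code x)) = code x"
        using AE_S by eventually_elim (simp add: S_def decode_code)
    qed measurable
    then show ?thesis
      by (subst (asm) AE_distr_iff) (auto simp: X_def)
  qed
  have "AE \<omega> in \<Omega>. \<forall>n. X n \<omega> \<in> S \<and> code (X n \<omega>) = Y n \<omega>"
    using AE_code by (simp add: AE_all_countable)
  then have "AE \<omega> in \<Omega>. convergent (\<lambda>n. X n \<omega>)"
    using AE_space
  proof eventually_elim
    case (elim \<omega>)
    then have "convergent (\<lambda>n. code (X n \<omega>))"
      using lim_Y[of \<omega>] by (auto simp: convergent_def)
    then show ?case
      using elim by (intro convergent_if_code_convergent) (auto simp: S_def)
  qed
  then obtain E where E: "{\<omega> \<in> space \<Omega>. \<not> convergent (\<lambda>n. X n \<omega>)} \<subseteq> E" "E \<in> null_sets \<Omega>"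
    unfolding eventually_ae_filter by blast
  \<comment> \<open>Replacing all values on the null set \<open>E\<close> by a constant makes the
    convergence hold everywhere, so that \<open>Z\<close> is measurable outright.\<close>
  define Z where "Z = (\<lambda>\<omega>. if \<omega> \<in> E then undefined else lim (\<lambda>n. X n \<omega>))"
  have "Z \<in> borel_measurable \<Omega>"
  proof (rule borel_measurable_LIMSEQ_metric)
    have [measurable]: "E \<in> sets \<Omega>" using E by blast
    show "(\<lambda>\<omega>. if \<omega> \<in> E then undefined else X n \<omega>) \<in> borel_measurable \<Omega>" for n
      by measurable
    show "(\<lambda>n. if \<omega> \<in> E then undefined else X n \<omega>) \<longlonglongrightarrow> Z \<omega>" if "\<omega> \<in> space \<Omega>" for \<omega>
      using E that by (auto simp: Z_def convergent_LIMSEQ_iff)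
  qed
  moreover have "AE \<omega> in \<Omega>. (\<lambda>n. X n \<omega>) \<longlonglongrightarrow> Z \<omega>"
    using AE_not_in[OF E(2)] AE_space
    by eventually_elim (use E(1) in \<open>auto simp: Z_def convergent_LIMSEQ_iff\<close>)
  ultimately show thesis
    using that \<Omega> \<rho>(1) X distr_X by blast
qed

subsection \<open>Almost sure limits with constant law\<close>

text \<open>Almost sure convergence implies weak convergence of the laws, and weak limits are
  unique. This is what preserves the time marginals in the limit.\<close>

lemma AE_tendsto_distr_const:
  fixes Z :: "'b \<Rightarrow> 'a::polish_space"
  assumes "prob_space \<Omega>" 
    and X: "\<And>n. X n \<in> borel_measurable \<Omega>" and Z: "Z \<in> borel_measurable \<Omega>"
    and lim: "AE \<omega> in \<Omega>. (\<lambda>n. X n \<omega>) \<longlonglongrightarrow> Z \<omega>"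
    and law: "\<And>n. distr \<Omega> borel (X n) = \<nu>"
  shows "distr \<Omega> borel Z = \<nu>"
proof -
  interpret prob_space \<Omega> by fact
  let ?N = "distr \<Omega> borel Z"
  interpret N: prob_space ?N
    using Z by (rule prob_space_distr)
  interpret \<nu>: prob_space \<nu>
    using X[of 0] law[of 0] prob_space_distr by metis
  have sets: "sets \<nu> = sets borel"
    using law[of 0] by (metis sets_distr)
  \<comment> \<open>Fatou gives one inequality on open sets; inner regularity and complements give equality.\<close>
  have open_le: "emeasure ?N U \<le> emeasure \<nu> U" if "open U" for U
  proof -
    have U [measurable]: "U \<in> sets borel" using that by simp
    note [measurable] = X Z
    have distr_U: "emeasure (distr \<Omega> borel Y) U = (\<integral>\<^sup>+\<omega>. indicator U (Y \<omega>) \<partial>\<Omega>)"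
      if [measurable]: "Y \<in> borel_measurable \<Omega>" for Y :: "'b \<Rightarrow> 'a"
      using nn_integral_distr[of Y \<Omega> borel "indicator U"] by simp
    have "emeasure ?N U = (\<integral>\<^sup>+\<omega>. indicator U (Z \<omega>) \<partial>\<Omega>)"
      by (rule distr_U) fact
    also have "\<dots> \<le> (\<integral>\<^sup>+\<omega>. liminf (\<lambda>n. indicator U (X n \<omega>)) \<partial>\<Omega>)"
    proof (rule nn_integral_mono_AE)
      show "AE \<omega> in \<Omega>. indicator U (Z \<omega>) \<le> (liminf (\<lambda>n. indicator U (X n \<omega>)) :: ennreal)"
        using lim
      proof eventually_elim
        case (elim \<omega>)
        show ?case
        proof (cases "Z \<omega> \<in> U")
          case True
          with elim that have "eventually (\<lambda>n. X n \<omega> \<in> U) sequentially"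
            by (rule topological_tendstoD[rotated 2, rotated])
          then have "eventually (\<lambda>n. 1 \<le> (indicator U (X n \<omega>) :: ennreal)) sequentially"
            by eventually_elim simp
          then show ?thesis
            using True by (simp add: Liminf_bounded)
        qed simp
      qed
    qed
    also have "\<dots> \<le> liminf (\<lambda>n. \<integral>\<^sup>+\<omega>. indicator U (X n \<omega>) \<partial>\<Omega>)"
      by (rule nn_integral_liminf) measurable
    also have "\<dots> = emeasure \<nu> U"
      by (simp add: distr_U[OF X, symmetric] law Liminf_const)
    finally show ?thesis .
  qed
  have compl: "emeasure M (- B) = 1 - emeasure M B"
    if "prob_space M" "sets M = sets borel" "B \<in> sets borel" for M and B :: "'a set"
  proof -
    interpret M: prob_space M by fact
    have "space M = UNIV"
      using that(2) by (metis sets_eq_imp_space_eq space_borel)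
    then show ?thesis
      using that M.emeasure_space_1 emeasure_compl[of B M] by (simp add: Compl_eq_Diff_UNIV)
  qed
  have closed_ge: "emeasure \<nu> K \<le> emeasure ?N K" if "closed K" for K
  proof -
    have "1 - emeasure ?N K \<le> 1 - emeasure \<nu> K"
      using open_le[of "- K"] that compl[of ?N K] compl[of \<nu> K] sets N.prob_space_axioms \<nu>.prob_space_axioms
      by (simp add: open_Compl)
    \<comment> \<open>Subtraction of extended nonnegative reals is truncated. Complementing a second
      time recovers the masses, since both are at most 1.\<close>
    then have "1 - (1 - emeasure \<nu> K) \<le> 1 - (1 - emeasure ?N K)"
      by (rule ennreal_minus_mono[OF order_refl])
    then show ?thesis
      using N.emeasure_le_1[of K] \<nu>.emeasure_le_1[of K] by (simp add: diff_diff_ennreal)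
  qed
  have ge: "emeasure \<nu> B \<le> emeasure ?N B" if "B \<in> sets borel" for B
    using that sets closed_ge
    by (subst (1 2) inner_regular) (auto intro!: SUP_mono compact_imp_closed)
  show ?thesis
  proof (rule measure_eqI)
    fix B assume "B \<in> sets ?N"
    then have B: "B \<in> sets borel" by simp
    have "1 - emeasure \<nu> B \<le> 1 - emeasure ?N B"
      using ge[of "- B"] B compl[of ?N B] compl[of \<nu> B] sets N.prob_space_axioms \<nu>.prob_space_axioms
      by simp
    then have "1 - (1 - emeasure ?N B) \<le> 1 - (1 - emeasure \<nu> B)"
      by (rule ennreal_minus_mono[OF order_refl])
    then show "emeasure ?N B = emeasure \<nu> B"
      using N.emeasure_le_1[of B] \<nu>.emeasure_le_1[of B] ge[OF B] by (simp add: diff_diff_ennreal)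
  qed (simp add: sets)
qed

subsection \<open>Path space\<close>

text \<open>Extending paths by constants identifies the path space with a subset of the type of bounded
  continuous functions, whose metric is available through type classes.\<close>

definition path_extend :: "real \<Rightarrow> (real \<Rightarrow> 'x::metric_space) \<Rightarrow> (real \<Rightarrow>\<^sub>C 'x)" where
  "path_extend T \<gamma> = Bcontfun (\<lambda>t. \<gamma> (max 0 (min T t)))"

definition path_restrict :: "real \<Rightarrow> (real \<Rightarrow>\<^sub>C 'x::metric_space) \<Rightarrow> (real \<Rightarrow> 'x)" where
  "path_restrict T f = restrict (apply_bcontfun f) {0..T}"

lemma apply_path_extend:
  assumes "0 \<le> T" "\<gamma> \<in> paths T"
  shows "apply_bcontfun (path_extend T \<gamma>) t = \<gamma> (max 0 (min T t))"
proof -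
  have cont: "continuous_on {0..T} \<gamma>"
    using assms(2) by (simp add: paths_eq)
  have "continuous_on UNIV (\<lambda>t. \<gamma> (max 0 (min T t)))"
    using assms(1) by (intro continuous_on_compose2[OF cont] continuous_intros) auto
  moreover have "bounded (range (\<lambda>t. \<gamma> (max 0 (min T t))))"
    using assms(1)
    by (intro bounded_subset[OF compact_imp_bounded[OF compact_continuous_image[OF cont compact_Icc]]]) auto
  ultimately show ?thesis
    by (simp add: path_extend_def Bcontfun_inverse bcontfun_def)
qed

lemma path_restrict_in_paths: "path_restrict T f \<in> paths T"
proof -
  have "continuous_on {0..T} (restrict (apply_bcontfun f) {0..T})"
    by (subst continuous_on_cong[OF refl, of _ _ "apply_bcontfun f"]) auto
  then show ?thesis
    by (simp add: paths_eq path_restrict_def)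
qed

lemma path_restrict_extend:
  assumes "0 \<le> T" "\<gamma> \<in> paths T"
  shows "path_restrict T (path_extend T \<gamma>) = \<gamma>"
proof -
  have "\<gamma> \<in> extensional {0..T}"
    using assms(2) by (simp add: paths_eq)
  then show ?thesis
    unfolding path_restrict_def
    by (intro extensionalityI[of _ "{0..T}"]) (auto simp: apply_path_extend[OF assms])
qed

text \<open>The clamped time stays in the interval, so extending does not increase the supremum
  distance; the map is 1-Lipschitz.\<close>

lemma continuous_map_path_extend:
  assumes "0 \<le> T"
  shows "continuous_map (path_topology T) euclidean (path_extend T :: (real \<Rightarrow> 'x::metric_space) \<Rightarrow> _)"
proof -
  have "Lipschitz_continuous_map (path_metric T) euclidean_metric (path_extend T :: (real \<Rightarrow> 'x) \<Rightarrow> _)"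
    unfolding Lipschitz_continuous_map_def
  proof (intro conjI exI[of _ 1] ballI)
    fix \<gamma> \<eta> :: "real \<Rightarrow> 'x"
    assume p: "\<gamma> \<in> paths T" "\<eta> \<in> paths T"
    have "dist (\<gamma> t) (\<eta> t) \<le> mdist (path_metric T) \<gamma> \<eta>" if "t \<in> {0..T}" for t
      using mdist_cfunspace_imp_mdist_le[of \<gamma> "top_of_set {0..T}" euclidean_metric \<eta> "mdist (path_metric T) \<gamma> \<eta>" t]
        p that by (simp add: path_metric_def)
    then have "dist (path_extend T \<gamma>) (path_extend T \<eta>) \<le> mdist (path_metric T) \<gamma> \<eta>"
      using assms p by (intro dist_bound) (simp add: apply_path_extend)
    then show "mdist euclidean_metric (path_extend T \<gamma>) (path_extend T \<eta>) \<le> 1 * mdist (path_metric T) \<gamma> \<eta>"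
      by simp
  qed auto
  then show ?thesis
    using Lipschitz_continuous_imp_continuous_map by fastforce
qed

lemma continuous_map_path_restrict:
  "continuous_map euclidean (path_topology T) (path_restrict T :: _ \<Rightarrow> (real \<Rightarrow> 'x::metric_space))"
proof -
  have "Lipschitz_continuous_map euclidean_metric (path_metric T) (path_restrict T :: _ \<Rightarrow> (real \<Rightarrow> 'x))"
    unfolding Lipschitz_continuous_map_def
  proof (intro conjI exI[of _ 1] ballI)
    fix f g :: "real \<Rightarrow>\<^sub>C 'x"
    have "mdist (path_metric T) (path_restrict T f) (path_restrict T g) \<le> dist f g"
      unfolding path_metric_def by (rule mdist_cfunspace_le) (auto simp: path_restrict_def dist_bounded)
    then show "mdist (path_metric T) (path_restrict T f) (path_restrict T g) \<le> 1 * mdist euclidean_metric f g"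
      by simp
  qed (auto simp: path_restrict_in_paths)
  then show ?thesis
    using Lipschitz_continuous_imp_continuous_map by fastforce
qed

lemma topspace_path_topology [simp]: "topspace (path_topology T) = paths T"
  by (simp add: topspace_mtopology_of)

lemma space_path_borel [simp]: "space (path_borel T) = paths T"
  unfolding path_borel_def using openin_subset by (subst space_measure_of) fastforce+

lemma sets_path_borel: "sets (path_borel T) = sigma_sets (paths T) {U. openin (path_topology T) U}"
  unfolding path_borel_def using openin_subset by (subst sets_measure_of) fastforce+

lemma openin_path_borel: "openin (path_topology T) U \<Longrightarrow> U \<in> sets (path_borel T)"
  by (simp add: sets_path_borel)

lemma path_restrict_measurable: "path_restrict T \<in> borel \<rightarrow>\<^sub>M path_borel T"
  unfolding path_borel_def
proof (rule measurable_measure_of)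
  show "path_restrict T -` U \<inter> space borel \<in> sets borel" if "U \<in> {U. openin (path_topology T) U}" for U
    using openin_continuous_map_preimage[OF continuous_map_path_restrict, of T U] that
    by (simp add: vimage_def)
qed (use openin_subset in \<open>fastforce simp: path_restrict_in_paths\<close>)+

lemma path_extend_measurable:
  assumes "0 \<le> T"
  shows "path_extend T \<in> borel_measurable (path_borel T)"
proof (rule borel_measurableI)
  fix S :: "(real \<Rightarrow>\<^sub>C 'a) set"
  assume "open S"
  then have "openin (path_topology T) {\<gamma> \<in> paths T. path_extend T \<gamma> \<in> S}"
    using openin_continuous_map_preimage[OF continuous_map_path_extend[OF assms]] by fastforce
  then show "path_extend T -` S \<inter> space (path_borel T) \<in> sets (path_borel T)"
    by (intro openin_path_borel) (simp add: vimage_def Int_def conj_commute)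
qed

subsection \<open>Lower semicontinuous maps\<close>

lemma lsc_map_openin_greater:
  assumes "lsc_map X f"
  shows "openin X {x \<in> topspace X. a < f x}"
proof (subst openin_subopen, intro ballI)
  fix x assume "x \<in> {x \<in> topspace X. a < f x}"
  then obtain U where "openin X U" "x \<in> U" "\<forall>y\<in>U. a < f y"
    using assms unfolding lsc_map_def by blast
  then show "\<exists>U. openin X U \<and> x \<in> U \<and> U \<subseteq> {x \<in> topspace X. a < f x}"
    using openin_subset by blast
qed

lemma lsc_map_path_borel_measurable:
  fixes \<Psi> :: "(real \<Rightarrow> 'x::metric_space) \<Rightarrow> ennreal"
  assumes "lsc_map (path_topology T) \<Psi>"
  shows "\<Psi> \<in> borel_measurable (path_borel T)"
  using openin_path_borel[OF lsc_map_openin_greater[OF assms]]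
  by (intro borel_measurableI_greater) simp

text \<open>Sublevels of a lower semicontinuous map are closed, so relative compactness already
  means compactness.\<close>

lemma lsc_map_compactin_sublevel:
  assumes "lsc_map X f" "relatively_compactin X {x \<in> topspace X. f x \<le> a}"
  shows "compactin X {x \<in> topspace X. f x \<le> a}"
proof -
  have "closedin X (topspace X - {x \<in> topspace X. a < f x})"
    using lsc_map_openin_greater[OF assms(1)] by blast
  also have "topspace X - {x \<in> topspace X. a < f x} = {x \<in> topspace X. f x \<le> a}"
    by auto
  finally show ?thesis
    using assms(2) by (simp add: relatively_compactin_def closure_of_closedin)
qed

lemma lsc_map_le_liminf:
  fixes f :: "'a \<Rightarrow> 'b::complete_linorder"
  assumes "lsc_map X f" "limitin X x l sequentially"
  shows "f l \<le> liminf (\<lambda>n. f (x n))"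
  unfolding le_Liminf_iff
proof (intro allI impI)
  fix a assume "a < f l"
  moreover have "l \<in> topspace X" using assms(2) by (rule limitin_topspace)
  ultimately obtain U where "openin X U" "l \<in> U" "\<forall>y\<in>U. a < f y"
    using assms(1) unfolding lsc_map_def by blast
  then show "\<forall>\<^sub>F n in sequentially. a < f (x n)"
    using assms(2) unfolding limitin_def by (metis (mono_tags, lifting) eventually_mono)
qed

subsection \<open>Existence of a minimiser\<close>

theorem proposition1p1:
  fixes T :: real
    and \<mu> :: "real \<Rightarrow> 'x::polish_space measure"
    and \<Psi> :: "(real \<Rightarrow> 'x) \<Rightarrow> ennreal"
  assumes "0 \<le> T"
    and "\<And>t. t \<in> {0..T} \<Longrightarrow> \<mu> t \<in> space (prob_algebra borel)"
    and "lsc_map (path_topology T) \<Psi>"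
    and "\<And>c::real. 0 \<le> c \<Longrightarrow>
           relatively_compactin (path_topology T) {\<gamma> \<in> paths T. \<Psi> \<gamma> \<le> ennreal c}"
    and "(INF \<pi>\<in>Lift T \<mu>. \<integral>\<^sup>+ \<gamma>. \<Psi> \<gamma> \<partial>\<pi>) < \<infinity>"
  shows "\<exists>\<pi>\<in>Lift T \<mu>. (\<integral>\<^sup>+ \<gamma>. \<Psi> \<gamma> \<partial>\<pi>) = (INF \<pi>'\<in>Lift T \<mu>. \<integral>\<^sup>+ \<gamma>. \<Psi> \<gamma> \<partial>\<pi>')"
proof -
  note T = assms(1) and lsc = assms(3)
  let ?m = "INF \<pi>\<in>Lift T \<mu>. \<integral>\<^sup>+ \<gamma>. \<Psi> \<gamma> \<partial>\<pi>"
  have meas_\<Psi> [measurable]: "\<Psi> \<in> borel_measurable (path_borel T)"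
    using lsc by (rule lsc_map_path_borel_measurable)
  note [measurable] = path_restrict_measurable path_extend_measurable[OF T]
  have "Lift T \<mu> \<noteq> {}"
    using assms(5) by auto
  then obtain v where v: "decseq v" "range v \<subseteq> (\<lambda>\<pi>. \<integral>\<^sup>+ \<gamma>. \<Psi> \<gamma> \<partial>\<pi>) ` Lift T \<mu>" "?m = (INF i. v i)"
    using ennreal_Inf_countable_INF[of "(\<lambda>\<pi>. \<integral>\<^sup>+ \<gamma>. \<Psi> \<gamma> \<partial>\<pi>) ` Lift T \<mu>"] by auto
  have "v \<longlonglongrightarrow> ?m"
    unfolding v(3) by (rule LIMSEQ_INF) fact
  \<comment> \<open>Early values may be infinite. Starting at index \<open>k\<close>, the decreasing
    sequence is bounded by the finite value \<open>v k\<close>.\<close>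
  obtain k where k: "v k < \<infinity>"
    using assms(5) unfolding v(3) INF_less_iff by blast
  have "\<forall>n. \<exists>\<pi>\<in>Lift T \<mu>. (\<integral>\<^sup>+ \<gamma>. \<Psi> \<gamma> \<partial>\<pi>) = v (n + k)"
    using v(2) by (auto simp: subset_iff image_iff) metis
  then obtain \<pi> where \<pi>: "\<And>n. \<pi> n \<in> Lift T \<mu>" "\<And>n. (\<integral>\<^sup>+ \<gamma>. \<Psi> \<gamma> \<partial>\<pi> n) = v (n + k)"
    by metis
  have lim: "(\<lambda>n. \<integral>\<^sup>+ \<gamma>. \<Psi> \<gamma> \<partial>\<pi> n) \<longlonglongrightarrow> ?m"
    unfolding \<pi>(2) using \<open>v \<longlonglongrightarrow> ?m\<close> by (rule LIMSEQ_ignore_initial_segment)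
  obtain b where b: "0 \<le> b" "\<And>n. (\<integral>\<^sup>+ \<gamma>. \<Psi> \<gamma> \<partial>\<pi> n) \<le> ennreal b"
  proof -
    obtain b where "0 \<le> b" "v k = ennreal b"
      using k by (cases "v k") auto
    moreover have "v (n + k) \<le> v k" for n
      using v(1) by (rule decseqD) simp
    ultimately show ?thesis
      using that \<pi>(2) by metis
  qed
  have sets_\<pi> [measurable_cong]: "sets (\<pi> n) = sets (path_borel T)" for n
    using \<pi>(1)[of n] by (simp add: Lift_def space_prob_algebra)
  have space_\<pi>: "space (\<pi> n) = paths T" for n
    using sets_eq_imp_space_eq[OF sets_\<pi>] by simp
  interpret \<pi>: prob_space "\<pi> n" for n
    using \<pi>(1)[of n] by (simp add: Lift_def space_prob_algebra)
  \<comment> \<open>The lifts are moved to bounded continuous functions, whose type is a complete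
    metric space, as the realization theorem requires.\<close>
  define M where "M n = distr (\<pi> n) borel (path_extend T)" for n
  define K where "K j = path_extend T ` {\<gamma> \<in> paths T. \<Psi> \<gamma> \<le> ennreal (real j)}" for j :: nat
  have compact_K: "compact (K j)" for j
    using image_compactin[OF lsc_map_compactin_sublevel[OF lsc] continuous_map_path_extend[OF T]]
      assms(4)[of "real j"] by (simp add: K_def)
  have tight: "\<exists>J. \<forall>n. 1 - e < measure (M n) (\<Union>j\<le>J. K j)" if "e > 0" for e :: real
  proof -
    \<comment> \<open>Markov's inequality bounds the mass where \<open>\<Psi>\<close> exceeds
      \<open>J\<close> by \<open>b / J\<close>, and this choice makes that bound smaller than
      \<open>e\<close>.\<close>
    obtain J :: nat where J: "b / e < real J"
      using reals_Archimedean2 by blast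
    then have J0: "real J > 0"
      using b(1) \<open>e > 0\<close> by (meson divide_nonneg_pos le_less_trans)
    have "1 - e < measure (M n) (\<Union>j\<le>J. K j)" for n
    proof -
      let ?A = "{\<gamma> \<in> space (\<pi> n). \<Psi> \<gamma> \<le> ennreal (real J)}"
      have [measurable]: "?A \<in> sets (\<pi> n)" by measurable
      have "emeasure (\<pi> n) (space (\<pi> n) - ?A) \<le> emeasure (\<pi> n) {\<gamma> \<in> space (\<pi> n). 1 \<le> ennreal (1 / real J) * \<Psi> \<gamma>}"
      proof (rule emeasure_mono)
        have "1 \<le> ennreal (1 / real J) * \<Psi> \<gamma>" if "ennreal (real J) < \<Psi> \<gamma>" for \<gamma>
        proof -
          have "1 = ennreal (1 / real J) * ennreal (real J)"
            using J0 by (simp add: ennreal_mult[symmetric])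
          also have "\<dots> \<le> ennreal (1 / real J) * \<Psi> \<gamma>"
            using that by (intro mult_left_mono) auto
          finally show ?thesis .
        qed
        then show "space (\<pi> n) - ?A \<subseteq> {\<gamma> \<in> space (\<pi> n). 1 \<le> ennreal (1 / real J) * \<Psi> \<gamma>}"
          by (auto simp: not_le)
      qed measurable
      also have "\<dots> \<le> ennreal (1 / real J) * (\<integral>\<^sup>+ \<gamma>. \<Psi> \<gamma> * indicator (space (\<pi> n)) \<gamma> \<partial>\<pi> n)"
        by (rule nn_integral_Markov_inequality) auto
      also have "(\<integral>\<^sup>+ \<gamma>. \<Psi> \<gamma> * indicator (space (\<pi> n)) \<gamma> \<partial>\<pi> n) = (\<integral>\<^sup>+ \<gamma>. \<Psi> \<gamma> \<partial>\<pi> n)"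
        by (rule nn_integral_cong) simp
      also have "ennreal (1 / real J) * \<dots> \<le> ennreal (1 / real J) * ennreal b"
        using b(2) by (intro mult_left_mono) auto
      also have "\<dots> = ennreal (b / real J)"
        using b(1) by (simp add: ennreal_mult[symmetric])
      finally have "measure (\<pi> n) (space (\<pi> n) - ?A) \<le> b / real J"
        using b(1) by (simp add: \<pi>.emeasure_eq_measure)
      also have "b / real J < e"
        using J J0 \<open>e > 0\<close> by (simp add: field_simps)
      finally have "1 - e < measure (\<pi> n) ?A"
        using \<pi>.prob_compl[of ?A n] by simp
      also have "\<dots> \<le> measure (\<pi> n) (path_extend T -` (\<Union>j\<le>J. K j) \<inter> space (\<pi> n))"
      proof (rule \<pi>.finite_measure_mono)
        show "?A \<subseteq> path_extend T -` (\<Union>j\<le>J. K j) \<inter> space (\<pi> n)"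
          by (auto simp: K_def space_\<pi>)
        have [measurable]: "K j \<in> sets borel" for j
          using compact_K by (simp add: compact_imp_closed)
        show "path_extend T -` (\<Union>j\<le>J. K j) \<inter> space (\<pi> n) \<in> sets (\<pi> n)"
          by measurable
      qed
      also have "\<dots> = measure (M n) (\<Union>j\<le>J. K j)"
        unfolding M_def
        by (rule measure_distr[symmetric])
          (auto intro!: sets.finite_UN borel_closed compact_imp_closed compact_K)
      finally show ?thesis .
    qed
    then show ?thesis by blast
  qed
  have M_prob: "M n \<in> space (prob_algebra borel)" for n
    unfolding M_def space_prob_algebra by (simp add: \<pi>.prob_space_distr)
  obtain \<Omega> :: "real measure" and X Z \<rho> where \<Omega>: "prob_space \<Omega>" and \<rho>: "strict_mono \<rho>"
    and X [measurable]: "\<And>n. X n \<in> borel_measurable \<Omega>"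
    and distr_X: "\<And>n. distr \<Omega> borel (X n) = M (\<rho> n)"
    and Z [measurable]: "Z \<in> borel_measurable \<Omega>"
    and lim_X: "AE \<omega> in \<Omega>. (\<lambda>n. X n \<omega>) \<longlonglongrightarrow> Z \<omega>"
    by (rule tight_imp_AE_convergent_realization[OF M_prob compact_K tight]) blast+
  interpret \<Omega>: prob_space \<Omega> by fact
  \<comment> \<open>On paths, restriction undoes extension, so the restricted variables have exactly
    the laws of the chosen lifts.\<close>
  have distr_restrict_X: "distr \<Omega> (path_borel T) (\<lambda>\<omega>. path_restrict T (X n \<omega>)) = \<pi> (\<rho> n)" for n
  proof -
    have "distr \<Omega> (path_borel T) (\<lambda>\<omega>. path_restrict T (X n \<omega>)) = distr (M (\<rho> n)) (path_borel T) (path_restrict T)"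
      unfolding distr_X[symmetric] by (subst distr_distr) (auto simp: comp_def)
    also have "\<dots> = distr (\<pi> (\<rho> n)) (path_borel T) (\<lambda>\<gamma>. path_restrict T (path_extend T \<gamma>))"
      unfolding M_def by (subst distr_distr) (auto simp: comp_def)
    also have "\<dots> = distr (\<pi> (\<rho> n)) (\<pi> (\<rho> n)) (\<lambda>\<gamma>. \<gamma>)"
      by (rule distr_cong) (auto simp: sets_\<pi> space_\<pi> path_restrict_extend[OF T])
    finally show ?thesis
      by (simp add: distr_id)
  qed
  define \<pi>' where "\<pi>' = distr \<Omega> (path_borel T) (\<lambda>\<omega>. path_restrict T (Z \<omega>))"
  have "\<pi>' \<in> Lift T \<mu>"
    unfolding Lift_def
  proof (intro CollectI conjI ballI)
    show "\<pi>' \<in> space (prob_algebra (path_borel T))"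
      unfolding \<pi>'_def space_prob_algebra by (simp add: \<Omega>.prob_space_distr)
    fix t assume t: "t \<in> {0..T}"
    note [measurable] = measurable_eval[OF t]
    have "distr \<pi>' borel (\<lambda>\<gamma>. \<gamma> t) = distr \<Omega> borel (\<lambda>\<omega>. path_restrict T (Z \<omega>) t)"
      unfolding \<pi>'_def by (subst distr_distr) (auto simp: comp_def)
    also have "\<dots> = \<mu> t"
    \<comment> \<open>Uniform convergence implies convergence at time \<open>t\<close>, and along
      the whole sequence the law at time \<open>t\<close> is \<open>\<mu> t\<close>.\<close>
    proof (rule AE_tendsto_distr_const[OF \<Omega>])
      show "(\<lambda>\<omega>. path_restrict T (X n \<omega>) t) \<in> borel_measurable \<Omega>" for n
        by measurable
      show "(\<lambda>\<omega>. path_restrict T (Z \<omega>) t) \<in> borel_measurable \<Omega>"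
        by measurable
      show "AE \<omega> in \<Omega>. (\<lambda>n. path_restrict T (X n \<omega>) t) \<longlonglongrightarrow> path_restrict T (Z \<omega>) t"
        using lim_X
      proof eventually_elim
        case (elim \<omega>)
        have "(\<lambda>n. apply_bcontfun (X n \<omega>) t) \<longlonglongrightarrow> apply_bcontfun (Z \<omega>) t"
          using tendsto_bcontfun_uniform_limit[OF elim] by (rule tendsto_uniform_limitI) simp
        then show ?case
          using t by (simp add: path_restrict_def)
      qed
      have "distr \<Omega> borel (\<lambda>\<omega>. path_restrict T (X n \<omega>) t) = distr (\<pi> (\<rho> n)) borel (\<lambda>\<gamma>. \<gamma> t)" for n
        unfolding distr_restrict_X[symmetric] by (subst distr_distr) (auto simp: comp_def)
      then show "distr \<Omega> borel (\<lambda>\<omega>. path_restrict T (X n \<omega>) t) = \<mu> t" for n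
        using \<pi>(1) t by (simp add: Lift_def)
    qed
    finally show "distr \<pi>' borel (\<lambda>\<gamma>. \<gamma> t) = \<mu> t" .
  qed
  moreover have "(\<integral>\<^sup>+ \<gamma>. \<Psi> \<gamma> \<partial>\<pi>') \<le> ?m"
  proof -
    have "(\<integral>\<^sup>+ \<gamma>. \<Psi> \<gamma> \<partial>\<pi>') = (\<integral>\<^sup>+ \<omega>. \<Psi> (path_restrict T (Z \<omega>)) \<partial>\<Omega>)"
      unfolding \<pi>'_def by (subst nn_integral_distr) auto
    also have "\<dots> \<le> (\<integral>\<^sup>+ \<omega>. liminf (\<lambda>n. \<Psi> (path_restrict T (X n \<omega>))) \<partial>\<Omega>)"
    proof (rule nn_integral_mono_AE)
      show "AE \<omega> in \<Omega>. \<Psi> (path_restrict T (Z \<omega>)) \<le> liminf (\<lambda>n. \<Psi> (path_restrict T (X n \<omega>)))"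
        using lim_X
      proof eventually_elim
        case (elim \<omega>)
        then have "limitin euclidean (\<lambda>n. X n \<omega>) (Z \<omega>) sequentially"
          by simp
        from continuous_map_limit[OF continuous_map_path_restrict this, of T]
        show ?case
          by (intro lsc_map_le_liminf[OF lsc]) (simp add: comp_def)
      qed
    qed
    also have "\<dots> \<le> liminf (\<lambda>n. \<integral>\<^sup>+ \<omega>. \<Psi> (path_restrict T (X n \<omega>)) \<partial>\<Omega>)"
      by (rule nn_integral_liminf) measurable
    also have "(\<lambda>n. \<integral>\<^sup>+ \<omega>. \<Psi> (path_restrict T (X n \<omega>)) \<partial>\<Omega>) = (\<lambda>n. \<integral>\<^sup>+ \<gamma>. \<Psi> \<gamma> \<partial>\<pi> (\<rho> n))"
      unfolding distr_restrict_X[symmetric] by (subst nn_integral_distr) auto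
    \<comment> \<open>The integrals along the subsequence converge to the infimum, so their lower
      limit equals it.\<close>
    also have "liminf \<dots> = ?m"
      using LIMSEQ_subseq_LIMSEQ[OF lim \<rho>] by (intro lim_imp_Liminf) (auto simp: comp_def)
    finally show ?thesis .
  qed
  ultimately show ?thesis
    by (intro bexI[of _ \<pi>'] antisym INF_lower)
qed

end
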